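(* Let $X \subseteq \mathbb{R}^n$ be an open set and let $\tilde f : X \to F(\mathbb{R})$ be a gH-differentiable fuzzy-valued function on $X$. If $\bar x^* \in X$ is a local minimizer of the problem "Minimize $\tilde f(\bar x)$, $\bar x \in X$" (with respect to the linear order relation $\preceq$ on $F(\mathbb{R})$), then $$\int_0^1 \alpha \,\big[\nabla(\tilde f_\alpha^L + \tilde f_\alpha^U)(\bar x^* )\big]\, d\alpha = 0 ,$$ where $\nabla$ denotes the ordinary gradient in $\bar x$ of the real-valued function $\tilde f_\alpha^L+\tilde f_\alpha^U$ and the integral is taken componentwise.
   Context: Fuzzy numbers. A fuzzy number is a function $\tilde a:\mathbb{R}\to[0,1]$ such that: (i) $\tilde a(r_0)=1$ for some $r_0\in\mathbb{R}$; (ii) $\tilde a(tr+(1-t)s)\ge\min\{\tilde a(r),\tilde a(s)\}$ for all $r,s\in\mathbb{R}$, $t\in[0,1]$; (iii) $\tilde a$ is upper semicontinuous; (iv) the closure of $\{r:\tilde a(r)>0\}$ is compact. $F(\mathbb{R})$ is the set of all fuzzy numbers. For $\alpha\in(0,1]$ the $\alpha$-level set is $\tilde a_\alpha=\{r:\tilde a(r)\ge\alpha\}$, and $\tilde a_0$ is the closure of $\{r:\tilde a(r)>0\}$; each is a compact interval written $\tilde a_\alpha=[\tilde a_\alpha^L,\tilde a_\alpha^U]$. A fuzzy number is determined by its level sets. Arithmetic. For $\alpha\in[0,1]$: $(\tilde a\oplus\tilde b)_\alpha=[\tilde a_\alpha^L+\tilde b_\alpha^L,\tilde a_\alpha^U+\tilde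 b_\alpha^U]$; for $\lambda\in\mathbb{R}$, $(\lambda\odot\tilde a)_\alpha=[\lambda\tilde a_\alpha^L,\lambda\tilde a_\alpha^U]$ if $\lambda\ge0$ and $[\lambda\tilde a_\alpha^U,\lambda\tilde a_\alpha^L]$ if $\lambda<0$. Order. $\tilde a\preceq\tilde b$ means $\int_0^1\alpha[\tilde a_\alpha^L+\tilde a_\alpha^U]\,d\alpha\le\int_0^1\alpha[\tilde b_\alpha^L+\tilde b_\alpha^U]\,d\alpha$. Metric. $d_F(\tilde a,\tilde b)=\sup_{0\le\alpha\le1}\max\{|\tilde a_\alpha^L-\tilde b_\alpha^L|,|\tilde a_\alpha^U-\tilde b_\alpha^U|\}$. Limits and continuity of fuzzy-valued functions are with respect to $d_F$. Level functions. For $\tilde f:X\to F(\mathbb{R})$ and $\alpha\in[0,1]$, $\tilde f_\alpha^L(\bar x)=(\tilde f(\bar x))_\alpha^L$ and $\tilde f_\alpha^U(\bar x)=(\tilde f(\bar x))_\alpha^U$. gH-difference. $\tilde a\ominus_{gH}\tilde b$ is the fuzzy number $\tilde c$, if it exists, such that $\tilde a=\tilde b\oplus\tilde c$ or $\tilde b=\tilde a\oplus((-1)\odot\tilde c)$. Its level sets are $[\min\{\tilde a_\alpha^L-\tilde b_\alpha^L,\tilde a_\alpha^U-\tilde b_\alpha^U\},\max\{\tilde a_\alpha^L-\tilde b_\alpha^L,\tilde a_\alpha^U-\tilde b_\alpha^U\}]$. gH-differentiability in one variable. For an open interval $I$, $\tilde g:I\to F(\mathbb{R})$ is gH-differentiable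 at $x_0\in I$ with gH-derivative $\tilde g'_{gH}(x_0)\in F(\mathbb{R})$ if $\tilde g'_{gH}(x_0)=\lim_{h\to0}\frac1h\odot\big(\tilde g(x_0+h)\ominus_{gH}\tilde g(x_0)\big)$ exists in $F(\mathbb{R})$. gH-differentiability in several variables. For $X\subseteq\mathbb{R}^n$ open, $\tilde f:X\to F(\mathbb{R})$ has $i$-th partial gH-derivative $D_i\tilde f(\bar x^0)=\frac{\partial\tilde f}{\partial x_i}(\bar x^0)$ at $\bar x^0\in X$ if the function $x_i\mapsto\tilde f(x_1^0,\dots,x_{i-1}^0,x_i,x_{i+1}^0,\dots,x_n^0)$ is gH-differentiable at $x_i^0$ with that gH-derivative. $\tilde f$ is gH-differentiable at $\bar x^0$ if one of the partial gH-derivatives exists at $\bar x^0$ and the remaining $n-1$ exist on some neighborhood of $\bar x^0$ and are continuous at $\bar x^0$. $\tilde f$ is gH-differentiable on $X$ if it is so at every point of $X$. Local minimizer. $\bar x^*\in X$ is a local minimizer if there is $\epsilon>0$ such that $\tilde f(\bar x^* )\preceq\tilde f(\bar x)$ for all $\bar x\in X$ with $\|\bar x-\bar x^*\|<\epsilon$. *)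

theory Defs
  imports "HOL-Analysis.Analysis"
begin

definition is_fuzzy_number :: "(real \<Rightarrow> real) \<Rightarrow> bool" where
  "is_fuzzy_number a \<longleftrightarrow>
     (\<forall>r. a r \<in> {0..1}) \<and>
     (\<exists>r. a r = 1) \<and>
     (\<forall>r s. \<forall>t\<in>{0..1}. a (t * r + (1 - t) * s) \<ge> min (a r) (a s)) \<and>
     (\<forall>c. open {r. a r < c}) \<and>
     compact (closure {r. a r > 0})"

typedef fuzzy = "{a. is_fuzzy_number a}" morphisms membership Abs_fuzzy
proof
  have "open {r::real. (if r = 0 then 1 else 0) < c}" for c :: real
  proof -
    have "{r::real. (if r = 0 then 1 else 0) < c} =
        (if c > 1 then UNIV else if c > 0 then - {0} else {})"
      by auto
    then show ?thesis
      by (simp add: open_Compl)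
  qed
  moreover have "{r::real. (if r = 0 then 1 else (0::real)) > 0} = {0}"
    by auto
  ultimately have "is_fuzzy_number (\<lambda>r. if r = 0 then 1 else 0)"
    unfolding is_fuzzy_number_def by auto
  then show "(\<lambda>r. if r = 0 then 1 else 0) \<in> {a. is_fuzzy_number a}"
    by simp
qed

definition level :: "fuzzy \<Rightarrow> real \<Rightarrow> real set" where
  "level a \<alpha> = (if \<alpha> = 0 then closure {r. membership a r > 0} else {r. membership a r \<ge> \<alpha>})"

definition lower :: "fuzzy \<Rightarrow> real \<Rightarrow> real" where
  "lower a \<alpha> = Inf (level a \<alpha>)"

definition upper :: "fuzzy \<Rightarrow> real \<Rightarrow> real" where
  "upper a \<alpha> = Sup (level a \<alpha>)"

lemma membership_fuzzy: "is_fuzzy_number (membership a)"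
  using membership[of a] by simp

lemma quasiconcave_superlevel:
  fixes a :: "real \<Rightarrow> real"
  assumes "\<And>r s t. t \<in> {0..1} \<Longrightarrow> a (t * r + (1 - t) * s) \<ge> min (a r) (a s)"
  shows "convex {r. a r \<ge> c}" "convex {r. a r > c}"
proof -
  have *: "min (a x) (a y) \<le> a (u * x + v * y)" if "0 \<le> u" "0 \<le> v" "u + v = 1" for x y u v
  proof -
    have "v = 1 - u" "u \<in> {0..1}" using that by auto
    then show ?thesis using assms by blast
  qed
  show "convex {r. a r \<ge> c}"
  proof (rule convexI)
    fix x y u v :: real
    assume "x \<in> {r. a r \<ge> c}" "y \<in> {r. a r \<ge> c}" "0 \<le> u" "0 \<le> v" "u + v = 1"
    then show "u *\<^sub>R x + v *\<^sub>R y \<in> {r. a r \<ge> c}"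
      using *[of u v x y] by simp
  qed
  show "convex {r. a r > c}"
  proof (rule convexI)
    fix x y u v :: real
    assume "x \<in> {r. a r > c}" "y \<in> {r. a r > c}" "0 \<le> u" "0 \<le> v" "u + v = 1"
    then show "u *\<^sub>R x + v *\<^sub>R y \<in> {r. a r > c}"
      using *[of u v x y] by simp
  qed
qed

lemma level_eq_Icc:
  assumes "\<alpha> \<in> {0..1}"
  shows "level a \<alpha> = {lower a \<alpha>..upper a \<alpha>}" and "lower a \<alpha> \<le> upper a \<alpha>"
proof -
  note fz = membership_fuzzy[of a, unfolded is_fuzzy_number_def]
  have qc: "\<And>r s t. t \<in> {0..1} \<Longrightarrow>
      membership a (t * r + (1 - t) * s) \<ge> min (membership a r) (membership a s)"
    using fz by blast
  have cpt0: "compact (closure {r. membership a r > 0})" using fz by blast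
  obtain r0 where r0: "membership a r0 = 1" using fz by blast
  have "r0 \<in> closure {r. membership a r > 0}"
    using r0 closure_subset by fastforce
  then have "r0 \<in> level a \<alpha>"
    using r0 assms unfolding level_def by simp
  then have ne: "level a \<alpha> \<noteq> {}" by blast
  have cpt: "compact (level a \<alpha>)"
  proof (cases "\<alpha> = 0")
    case True
    then show ?thesis using cpt0 by (simp add: level_def)
  next
    case False
    have "{r. membership a r \<ge> \<alpha>} = - {r. membership a r < \<alpha>}" by auto
    moreover have "open {r. membership a r < \<alpha>}" using fz by blast
    ultimately have "closed {r. membership a r \<ge> \<alpha>}" by (metis closed_Compl)
    moreover have "{r. membership a r \<ge> \<alpha>} \<subseteq> closure {r. membership a r > 0}"
      using False assms by (intro subset_trans[OF _ closure_subset]) auto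
    ultimately show ?thesis
      using False cpt0 by (metis compact_Int_closed inf.absorb_iff2 level_def)
  qed
  have "convex (level a \<alpha>)"
    using quasiconcave_superlevel[of "membership a", OF qc]
    by (auto simp: level_def intro: convex_closure)
  then have "connected (level a \<alpha>)" by (rule convex_connected)
  with cpt obtain p q where pq: "level a \<alpha> = {p..q}"
    using connected_compact_interval_1 by blast
  with ne have "p \<le> q" by auto
  with pq show "level a \<alpha> = {lower a \<alpha>..upper a \<alpha>}" "lower a \<alpha> \<le> upper a \<alpha>"
    by (simp_all add: lower_def upper_def)
qed

lemma level_antimono:
  assumes "0 \<le> \<alpha>" "\<alpha> \<le> \<beta>" "\<beta> \<le> 1"
  shows "level a \<beta> \<subseteq> level a \<alpha>"
proof -
  have "{r. membership a r \<ge> \<beta>} \<subseteq> closure {r. membership a r > 0}" if "\<beta> > 0"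
    using that by (intro subset_trans[OF _ closure_subset]) auto
  then show ?thesis using assms by (auto simp: level_def)
qed

lemma lower_upper_mono:
  assumes "0 \<le> \<alpha>" "\<alpha> \<le> \<beta>" "\<beta> \<le> 1"
  shows "lower a \<alpha> \<le> lower a \<beta>" "upper a \<beta> \<le> upper a \<alpha>"
proof -
  have "{lower a \<beta>..upper a \<beta>} \<subseteq> {lower a \<alpha>..upper a \<alpha>}"
    using level_antimono[OF assms, of a] level_eq_Icc(1)[of \<alpha> a] level_eq_Icc(1)[of \<beta> a] assms
    by auto
  moreover have "lower a \<beta> \<le> upper a \<beta>" using level_eq_Icc(2) assms by auto
  ultimately show "lower a \<alpha> \<le> lower a \<beta>" "upper a \<beta> \<le> upper a \<alpha>" by auto
qed

lemma fuzzy_eqI: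
  assumes "\<And>\<alpha>. \<alpha> \<in> {0..1} \<Longrightarrow> level a \<alpha> = level b \<alpha>"
  shows "a = b"
proof -
  have le: "membership x r \<le> membership y r"
    if eq: "\<And>\<alpha>. \<alpha> \<in> {0..1} \<Longrightarrow> level x \<alpha> = level y \<alpha>" for x y r
  proof -
    have "membership x r \<in> {0..1}" "membership y r \<in> {0..1}"
      using membership_fuzzy unfolding is_fuzzy_number_def by blast+
    then show ?thesis
      using eq[of "membership x r"] by (cases "membership x r = 0") (auto simp: level_def)
  qed
  have "membership a = membership b"
    using le[of a b] le[of b a] assms by (intro ext antisym) auto
  then show ?thesis by (simp add: membership_inject)
qed

lemma fuzzy_eqI':
  assumes "\<And>\<alpha>. \<alpha> \<in> {0..1} \<Longrightarrow> lower a \<alpha> = lower b \<alpha> \<and> upper a \<alpha> = upper b \<alpha>"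
  shows "a = b"
  using assms level_eq_Icc(1) by (intro fuzzy_eqI) auto

instantiation fuzzy :: metric_space
begin

definition dist_fuzzy :: "fuzzy \<Rightarrow> fuzzy \<Rightarrow> real" where
  "dist_fuzzy a b =
     (SUP \<alpha>\<in>{0..1}. max \<bar>lower a \<alpha> - lower b \<alpha>\<bar> \<bar>upper a \<alpha> - upper b \<alpha>\<bar>)"

definition uniformity_fuzzy :: "(fuzzy \<times> fuzzy) filter" where
  "uniformity_fuzzy = (INF e\<in>{0<..}. principal {(x, y). dist x y < e})"

definition open_fuzzy :: "fuzzy set \<Rightarrow> bool" where
  "open_fuzzy S \<longleftrightarrow> (\<forall>x\<in>S. \<forall>\<^sub>F (x', y) in uniformity. x' = x \<longrightarrow> y \<in> S)"

lemma dist_fuzzy_ge: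
  fixes a b :: fuzzy
  assumes "\<alpha> \<in> {0..1}"
  shows "\<bar>lower a \<alpha> - lower b \<alpha>\<bar> \<le> dist a b" "\<bar>upper a \<alpha> - upper b \<alpha>\<bar> \<le> dist a b"
proof -
  let ?g = "\<lambda>\<alpha>. max \<bar>lower a \<alpha> - lower b \<alpha>\<bar> \<bar>upper a \<alpha> - upper b \<alpha>\<bar>"
  have "?g \<beta> \<le> \<bar>lower a 0\<bar> + \<bar>upper a 0\<bar> + \<bar>lower b 0\<bar> + \<bar>upper b 0\<bar>" if "\<beta> \<in> {0..1}" for \<beta>
    using that lower_upper_mono[of 0 \<beta> a] lower_upper_mono[of 0 \<beta> b]
      level_eq_Icc(2)[of \<beta> a] level_eq_Icc(2)[of \<beta> b] by auto
  then have "bdd_above (?g ` {0..1})" by (intro bdd_aboveI2)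
  then have "?g \<alpha> \<le> dist a b"
    unfolding dist_fuzzy_def using assms by (intro cSUP_upper)
  then show "\<bar>lower a \<alpha> - lower b \<alpha>\<bar> \<le> dist a b" "\<bar>upper a \<alpha> - upper b \<alpha>\<bar> \<le> dist a b"
    by auto
qed

instance
proof
  fix x y z :: fuzzy
  show "dist x y = 0 \<longleftrightarrow> x = y"
  proof
    assume "dist x y = 0"
    then show "x = y"
      using dist_fuzzy_ge[of _ x y] by (intro fuzzy_eqI') auto
  next
    assume "x = y"
    then show "dist x y = 0" by (simp add: dist_fuzzy_def)
  qed
  have "max \<bar>lower x \<alpha> - lower y \<alpha>\<bar> \<bar>upper x \<alpha> - upper y \<alpha>\<bar> \<le> dist x z + dist y z"
    if "\<alpha> \<in> {0..1}" for \<alpha>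
    using dist_fuzzy_ge[OF that, of x z] dist_fuzzy_ge[OF that, of y z] by linarith
  then show "dist x y \<le> dist x z + dist y z"
    unfolding dist_fuzzy_def[of x y] by (intro cSUP_least) auto
qed (simp_all add: uniformity_fuzzy_def open_fuzzy_def)

end

definition fuzzy_add :: "fuzzy \<Rightarrow> fuzzy \<Rightarrow> fuzzy" where
  "fuzzy_add a b = (THE c. \<forall>\<alpha>\<in>{0..1}.
     level c \<alpha> = {lower a \<alpha> + lower b \<alpha> .. upper a \<alpha> + upper b \<alpha>})"

definition fuzzy_scale :: "real \<Rightarrow> fuzzy \<Rightarrow> fuzzy" where
  "fuzzy_scale k a = (THE c. \<forall>\<alpha>\<in>{0..1}.
     level c \<alpha> = (if k \<ge> 0 then {k * lower a \<alpha> .. k * upper a \<alpha>}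
                   else {k * upper a \<alpha> .. k * lower a \<alpha>}))"

definition fuzzy_le :: "fuzzy \<Rightarrow> fuzzy \<Rightarrow> bool" where
  "fuzzy_le a b \<longleftrightarrow>
     integral {0..1} (\<lambda>\<alpha>. \<alpha> * (lower a \<alpha> + upper a \<alpha>)) \<le>
     integral {0..1} (\<lambda>\<alpha>. \<alpha> * (lower b \<alpha> + upper b \<alpha>))"

text \<open>The descriptions above are proper: the required fuzzy numbers exist and are unique.\<close>

lemma fuzzy_representation:
  fixes l u :: "real \<Rightarrow> real"
  assumes le: "\<And>\<alpha>. 0 \<le> \<alpha> \<Longrightarrow> \<alpha> \<le> 1 \<Longrightarrow> l \<alpha> \<le> u \<alpha>"
    and mono: "\<And>\<alpha> \<beta>. 0 \<le> \<alpha> \<Longrightarrow> \<alpha> \<le> \<beta> \<Longrightarrow> \<beta> \<le> 1 \<Longrightarrow> l \<alpha> \<le> l \<beta> \<and> u \<beta> \<le> u \<alpha>"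
    and left: "\<And>\<alpha> e. 0 < \<alpha> \<Longrightarrow> \<alpha> \<le> 1 \<Longrightarrow> 0 < e \<Longrightarrow>
      \<exists>\<beta>. 0 \<le> \<beta> \<and> \<beta> < \<alpha> \<and> l \<alpha> - e < l \<beta> \<and> u \<beta> < u \<alpha> + e"
    and right: "\<And>e. 0 < e \<Longrightarrow> \<exists>\<beta>. 0 < \<beta> \<and> \<beta> \<le> 1 \<and> l \<beta> < l 0 + e \<and> u 0 - e < u \<beta>"
  shows "\<exists>c. \<forall>\<alpha>\<in>{0..1}. level c \<alpha> = {l \<alpha>..u \<alpha>}"
proof -
  define A where "A x = {\<alpha>. \<alpha> \<in> {0..1} \<and> l \<alpha> \<le> x \<and> x \<le> u \<alpha>}" for x
  define c where "c x = (if A x = {} then 0 else Sup (A x))" for x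
  have bdd: "bdd_above (A x)" for x by (rule bdd_aboveI[of _ 1]) (auto simp: A_def)
  have c01: "c x \<in> {0..1}" for x
  proof (cases "A x = {}")
    case False
    then obtain \<alpha> where "\<alpha> \<in> A x" by auto
    then have "0 \<le> \<alpha>" "\<alpha> \<le> Sup (A x)" using cSup_upper[OF _ bdd] by (simp_all add: A_def)
    moreover have "Sup (A x) \<le> 1" using False by (intro cSup_least) (auto simp: A_def)
    ultimately show ?thesis using False by (auto simp: c_def)
  qed (simp add: c_def)
  have lev: "c x \<ge> \<alpha> \<longleftrightarrow> l \<alpha> \<le> x \<and> x \<le> u \<alpha>" if \<alpha>: "0 < \<alpha>" "\<alpha> \<le> 1" for x \<alpha>
  proof
    assume "l \<alpha> \<le> x \<and> x \<le> u \<alpha>"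
    then have "\<alpha> \<in> A x" using that by (simp add: A_def)
    then show "c x \<ge> \<alpha>" unfolding c_def using cSup_upper[OF _ bdd, of \<alpha> x] by auto
  next
    assume cx: "c x \<ge> \<alpha>"
    then have "c x \<noteq> 0" using \<alpha> by linarith
    then have ne: "A x \<noteq> {}" unfolding c_def by meson
    have below: "l \<beta> \<le> x \<and> x \<le> u \<beta>" if "0 \<le> \<beta>" "\<beta> < \<alpha>" for \<beta>
    proof -
      have "\<beta> < Sup (A x)" using cx ne that by (simp add: c_def)
      then obtain \<gamma> where "\<gamma> \<in> A x" "\<beta> < \<gamma>" using less_cSup_iff[OF ne bdd] by blast
      moreover from this have "\<gamma> \<le> 1" "l \<gamma> \<le> x" "x \<le> u \<gamma>" by (auto simp: A_def)
      ultimately show ?thesis using mono[of \<beta> \<gamma>] that by linarith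
    qed
    show "l \<alpha> \<le> x \<and> x \<le> u \<alpha>"
    proof (rule ccontr)
      assume "\<not> ?thesis"
      then consider "x < l \<alpha>" | "u \<alpha> < x" by linarith
      then show False
      proof cases
        case 1
        then obtain \<beta> where "0 \<le> \<beta>" "\<beta> < \<alpha>" "l \<alpha> - (l \<alpha> - x) < l \<beta>"
          using left[of \<alpha> "l \<alpha> - x"] \<alpha> by auto
        with below[of \<beta>] show False by simp
      next
        case 2
        then obtain \<beta> where "0 \<le> \<beta>" "\<beta> < \<alpha>" "u \<beta> < u \<alpha> + (x - u \<alpha>)"
          using left[of \<alpha> "x - u \<alpha>"] \<alpha> by auto
        with below[of \<beta>] show False by simp
      qed
    qed
  qed
  have qc: "c (t * r + (1 - t) * s) \<ge> min (c r) (c s)" if t: "t \<in> {0..1}" for r s t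
  proof (cases "min (c r) (c s) > 0")
    case True
    define m where "m = min (c r) (c s)"
    have m: "0 < m" "m \<le> c r" "m \<le> c s" using True by (simp_all add: m_def)
    moreover have "c r \<le> 1" using c01[of r] by simp
    ultimately have m: "0 < m" "m \<le> 1" "m \<le> c r" "m \<le> c s" by linarith+
    then have "r \<in> {l m..u m}" "s \<in> {l m..u m}"
      using lev[OF m(1,2), of r] lev[OF m(1,2), of s] by simp_all
    then have "t *\<^sub>R r + (1 - t) *\<^sub>R s \<in> {l m..u m}"
      using t by (intro convexD[OF convex_real_interval(5)]) auto
    then show ?thesis using lev[OF m(1,2)] by (simp add: m_def)
  next
    case False
    then have "min (c r) (c s) \<le> 0" by linarith
    also have "0 \<le> c (t * r + (1 - t) * s)" using c01[of "t * r + (1 - t) * s"] by simp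
    finally show ?thesis .
  qed
  have pos_sub: "{r. c r > 0} \<subseteq> {l 0..u 0}"
  proof
    fix r assume "r \<in> {r. c r > 0}"
    then have "l (c r) \<le> r \<and> r \<le> u (c r)" using lev[of "c r" r] c01[of r] by simp
    moreover have "l 0 \<le> l (c r) \<and> u (c r) \<le> u 0" using c01[of r] by (intro mono) simp_all
    ultimately show "r \<in> {l 0..u 0}" by simp
  qed
  have in_pos: "l \<beta> \<in> {r. c r > 0}" "u \<beta> \<in> {r. c r > 0}" if "0 < \<beta>" "\<beta> \<le> 1" for \<beta>
  proof -
    have "l \<beta> \<le> u \<beta>" using le that by simp
    then have "c (l \<beta>) \<ge> \<beta>" "c (u \<beta>) \<ge> \<beta>" using lev[OF that] by simp_all
    then show "l \<beta> \<in> {r. c r > 0}" "u \<beta> \<in> {r. c r > 0}" using that by simp_all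
  qed
  have clos: "closure {r. c r > 0} = {l 0..u 0}"
  proof
    show "closure {r. c r > 0} \<subseteq> {l 0..u 0}"
      using pos_sub by (intro closure_minimal) auto
    have "l 0 \<in> closure {r. c r > 0}"
      unfolding closure_approachable
    proof (intro allI impI)
      fix e :: real assume "0 < e"
      then obtain \<beta> where b: "0 < \<beta>" "\<beta> \<le> 1" "l \<beta> < l 0 + e" using right by blast
      then have "dist (l \<beta>) (l 0) < e" using mono[of 0 \<beta>] by (auto simp: dist_real_def)
      then show "\<exists>y\<in>{r. c r > 0}. dist y (l 0) < e" using in_pos b by blast
    qed
    moreover have "u 0 \<in> closure {r. c r > 0}"
      unfolding closure_approachable
    proof (intro allI impI)
      fix e :: real assume "0 < e"
      then obtain \<beta> where b: "0 < \<beta>" "\<beta> \<le> 1" "u 0 - e < u \<beta>" using right by blast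
      then have "dist (u \<beta>) (u 0) < e" using mono[of 0 \<beta>] by (auto simp: dist_real_def)
      then show "\<exists>y\<in>{r. c r > 0}. dist y (u 0) < e" using in_pos b by blast
    qed
    moreover have "connected (closure {r. c r > 0})"
      using quasiconcave_superlevel(2)[of c, OF qc] by (intro convex_connected convex_closure)
    ultimately show "{l 0..u 0} \<subseteq> closure {r. c r > 0}"
      by (intro connected_contains_Icc)
  qed
  have op: "open {r. c r < d}" for d
  proof -
    consider "d \<le> 0" | "0 < d" "d \<le> 1" | "1 < d" by linarith
    then show ?thesis
    proof cases
      case 1
      have "\<not> c r < d" for r using c01[of r] 1 by simp
      then have "{r. c r < d} = {}" by blast
      then show ?thesis by simp
    next
      case 2
      have *: "c r < d \<longleftrightarrow> \<not> (l d \<le> r \<and> r \<le> u d)" for r using lev[OF 2, of r] by linarith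
      have "{r. c r < d} = - {l d..u d}"
        by (intro set_eqI) (simp only: mem_Collect_eq Compl_iff atLeastAtMost_iff *)
      then show ?thesis by (simp add: open_Compl)
    next
      case 3
      have "c r < d" for r using c01[of r] 3 by simp
      then have "{r. c r < d} = UNIV" by blast
      then show ?thesis by simp
    qed
  qed
  have "c (l 1) = 1" using lev[of 1 "l 1"] le[of 1] c01[of "l 1"] by auto
  then have "is_fuzzy_number c"
    unfolding is_fuzzy_number_def
  proof (intro conjI)
    show "compact (closure {r. c r > 0})" using clos by simp
    show "\<forall>r. c r \<in> {0..1}" using c01 by (intro allI)
    show "\<forall>r s. \<forall>t\<in>{0..1}. c (t * r + (1 - t) * s) \<ge> min (c r) (c s)"
      using qc by (intro allI ballI)
    show "\<forall>d. open {r. c r < d}" using op by (intro allI)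
  qed (rule exI)
  then have mem: "membership (Abs_fuzzy c) = c" by (simp add: Abs_fuzzy_inverse)
  have "level (Abs_fuzzy c) \<alpha> = {l \<alpha>..u \<alpha>}" if "\<alpha> \<in> {0..1}" for \<alpha>
  proof (cases "\<alpha> = 0")
    case True
    then show ?thesis using clos by (simp add: level_def mem)
  next
    case False
    then have *: "c r \<ge> \<alpha> \<longleftrightarrow> l \<alpha> \<le> r \<and> r \<le> u \<alpha>" for r using that by (intro lev) auto
    show ?thesis
      using False
      by (intro set_eqI) (simp only: level_def mem if_False mem_Collect_eq atLeastAtMost_iff *)
  qed
  then show ?thesis by blast
qed

lemma level_left_continuous:
  assumes "0 < \<alpha>" "\<alpha> \<le> 1" "0 < e"
  shows "\<exists>\<beta>. 0 \<le> \<beta> \<and> \<beta> < \<alpha> \<and> lower a \<alpha> - e < lower a \<beta> \<and> upper a \<beta> < upper a \<alpha> + e"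
proof -
  have mem: "membership a r \<ge> \<gamma> \<longleftrightarrow> lower a \<gamma> \<le> r \<and> r \<le> upper a \<gamma>" if "0 < \<gamma>" "\<gamma> \<le> 1" for \<gamma> r
  proof -
    have "membership a r \<ge> \<gamma> \<longleftrightarrow> r \<in> level a \<gamma>" using that by (simp add: level_def)
    also have "level a \<gamma> = {lower a \<gamma>..upper a \<gamma>}" using that by (intro level_eq_Icc(1)) simp
    finally show ?thesis by simp
  qed
  define p where "p = lower a \<alpha> - e"
  define q where "q = upper a \<alpha> + e"
  have lt: "membership a p < \<alpha>" "membership a q < \<alpha>"
    using mem[OF assms(1,2), of p] mem[OF assms(1,2), of q] assms(3)
    unfolding p_def q_def by linarith+
  have "\<exists>\<beta>>max 0 (max (membership a p) (membership a q)). \<beta> < \<alpha>"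
    using lt assms by (intro dense) simp
  then obtain \<beta> where b: "0 < \<beta>" "\<beta> < \<alpha>" "membership a p < \<beta>" "membership a q < \<beta>"
    by auto
  have "lower a \<beta> \<le> lower a \<alpha>" "upper a \<alpha> \<le> upper a \<beta>" "lower a \<alpha> \<le> upper a \<alpha>"
    using lower_upper_mono[of \<beta> \<alpha> a] level_eq_Icc(2)[of \<alpha> a] b assms by auto
  then have "p < lower a \<beta>" "upper a \<beta> < q"
    using mem[of \<beta> p] mem[of \<beta> q] b assms unfolding p_def q_def by linarith+
  then show ?thesis using b(1,2) unfolding p_def q_def by (intro exI[of _ \<beta>]) simp
qed

lemma level_right_continuous_0:
  assumes "0 < e"
  shows "\<exists>\<beta>. 0 < \<beta> \<and> \<beta> \<le> 1 \<and> lower a \<beta> < lower a 0 + e \<and> upper a 0 - e < upper a \<beta>"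
proof -
  have mem: "membership a r \<ge> \<gamma> \<Longrightarrow> lower a \<gamma> \<le> r \<and> r \<le> upper a \<gamma>" if "0 < \<gamma>" "\<gamma> \<le> 1" for \<gamma> r
    using level_eq_Icc(1)[of \<gamma> a] that by (auto simp: level_def)
  have "lower a 0 \<in> level a 0" "upper a 0 \<in> level a 0"
    using level_eq_Icc[of 0 a] by auto
  then have "\<exists>r\<in>{r. membership a r > 0}. dist r (lower a 0) < e"
      "\<exists>s\<in>{r. membership a r > 0}. dist s (upper a 0) < e"
    using assms by (simp_all add: level_def closure_approachable)
  then obtain r s where rs: "membership a r > 0" "dist r (lower a 0) < e"
      "membership a s > 0" "dist s (upper a 0) < e"
    by blast
  define \<beta> where "\<beta> = min (membership a r) (membership a s)"
  have "membership a r \<le> 1"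
    using membership_fuzzy[of a] unfolding is_fuzzy_number_def by auto
  then have b: "0 < \<beta>" "\<beta> \<le> 1" "\<beta> \<le> membership a r" "\<beta> \<le> membership a s"
    using rs by (auto simp: \<beta>_def)
  then have "lower a \<beta> \<le> r" "s \<le> upper a \<beta>" using mem by blast+
  then show ?thesis using b rs by (intro exI[of _ \<beta>]) (auto simp: dist_real_def)
qed

lemma level_description:
  assumes "\<exists>c. \<forall>\<alpha>\<in>{0..1}. level c \<alpha> = S \<alpha>" and "\<alpha> \<in> {0..1}"
  shows "level (THE c. \<forall>\<alpha>\<in>{0..1}. level c \<alpha> = S \<alpha>) \<alpha> = S \<alpha>"
proof -
  have "\<exists>!c. \<forall>\<alpha>\<in>{0..1}. level c \<alpha> = S \<alpha>"
    using assms(1) by (auto intro!: fuzzy_eqI)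
  from theI'[OF this] show ?thesis using assms(2) by blast
qed

lemma level_fuzzy_add:
  assumes "\<alpha> \<in> {0..1}"
  shows "level (fuzzy_add a b) \<alpha> = {lower a \<alpha> + lower b \<alpha> .. upper a \<alpha> + upper b \<alpha>}"
  unfolding fuzzy_add_def
proof (rule level_description[OF fuzzy_representation assms])
  fix \<alpha> :: real assume "0 \<le> \<alpha>" "\<alpha> \<le> 1"
  then show "lower a \<alpha> + lower b \<alpha> \<le> upper a \<alpha> + upper b \<alpha>"
    by (intro add_mono level_eq_Icc(2)) auto
next
  fix \<alpha> \<beta> :: real assume "0 \<le> \<alpha>" "\<alpha> \<le> \<beta>" "\<beta> \<le> 1"
  then show "lower a \<alpha> + lower b \<alpha> \<le> lower a \<beta> + lower b \<beta> \<and>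
      upper a \<beta> + upper b \<beta> \<le> upper a \<alpha> + upper b \<alpha>"
    by (intro conjI add_mono lower_upper_mono)
next
  fix \<alpha> e :: real assume A: "0 < \<alpha>" "\<alpha> \<le> 1" "0 < e"
  obtain \<beta> where b: "0 \<le> \<beta>" "\<beta> < \<alpha>" "lower a \<alpha> - e/2 < lower a \<beta>" "upper a \<beta> < upper a \<alpha> + e/2"
    using level_left_continuous[of \<alpha> "e/2" a] A by auto
  obtain \<gamma> where c: "0 \<le> \<gamma>" "\<gamma> < \<alpha>" "lower b \<alpha> - e/2 < lower b \<gamma>" "upper b \<gamma> < upper b \<alpha> + e/2"
    using level_left_continuous[of \<alpha> "e/2" b] A by auto
  show "\<exists>\<beta>. 0 \<le> \<beta> \<and> \<beta> < \<alpha> \<and> lower a \<alpha> + lower b \<alpha> - e < lower a \<beta> + lower b \<beta> \<and>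
      upper a \<beta> + upper b \<beta> < upper a \<alpha> + upper b \<alpha> + e"
  proof (intro exI conjI)
    have m: "\<beta> \<le> max \<beta> \<gamma>" "\<gamma> \<le> max \<beta> \<gamma>" "max \<beta> \<gamma> \<le> 1" using b c A by auto
    note * = lower_upper_mono[OF b(1) m(1,3), of a] lower_upper_mono[OF c(1) m(2,3), of b]
    show "0 \<le> max \<beta> \<gamma>" "max \<beta> \<gamma> < \<alpha>" using b c by auto
    show "lower a \<alpha> + lower b \<alpha> - e < lower a (max \<beta> \<gamma>) + lower b (max \<beta> \<gamma>)"
      using * b(3) c(3) by linarith
    show "upper a (max \<beta> \<gamma>) + upper b (max \<beta> \<gamma>) < upper a \<alpha> + upper b \<alpha> + e"
      using * b(4) c(4) by linarith
  qed
next
  fix e :: real assume A: "0 < e"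
  obtain \<beta> where b: "0 < \<beta>" "\<beta> \<le> 1" "lower a \<beta> < lower a 0 + e/2" "upper a 0 - e/2 < upper a \<beta>"
    using level_right_continuous_0[of "e/2" a] A by auto
  obtain \<gamma> where c: "0 < \<gamma>" "\<gamma> \<le> 1" "lower b \<gamma> < lower b 0 + e/2" "upper b 0 - e/2 < upper b \<gamma>"
    using level_right_continuous_0[of "e/2" b] A by auto
  show "\<exists>\<beta>. 0 < \<beta> \<and> \<beta> \<le> 1 \<and> lower a \<beta> + lower b \<beta> < lower a 0 + lower b 0 + e \<and>
      upper a 0 + upper b 0 - e < upper a \<beta> + upper b \<beta>"
  proof (intro exI conjI)
    have m: "0 \<le> min \<beta> \<gamma>" "min \<beta> \<gamma> \<le> \<beta>" "min \<beta> \<gamma> \<le> \<gamma>" using b c by auto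
    note * = lower_upper_mono[OF m(1,2) b(2), of a] lower_upper_mono[OF m(1,3) c(2), of b]
    show "0 < min \<beta> \<gamma>" "min \<beta> \<gamma> \<le> 1" using b c by auto
    show "lower a (min \<beta> \<gamma>) + lower b (min \<beta> \<gamma>) < lower a 0 + lower b 0 + e"
      using * b(3) c(3) by linarith
    show "upper a 0 + upper b 0 - e < upper a (min \<beta> \<gamma>) + upper b (min \<beta> \<gamma>)"
      using * b(4) c(4) by linarith
  qed
qed

lemma level_fuzzy_scale:
  assumes "\<alpha> \<in> {0..1}"
  shows "level (fuzzy_scale k a) \<alpha> =
    (if k \<ge> 0 then {k * lower a \<alpha> .. k * upper a \<alpha>} else {k * upper a \<alpha> .. k * lower a \<alpha>})"
proof -
  define l where "l \<alpha> = (if k \<ge> 0 then k * lower a \<alpha> else k * upper a \<alpha>)" for \<alpha>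
  define u where "u \<alpha> = (if k \<ge> 0 then k * upper a \<alpha> else k * lower a \<alpha>)" for \<alpha>
  have lu: "(if k \<ge> 0 then {k * lower a \<alpha> .. k * upper a \<alpha>} else {k * upper a \<alpha> .. k * lower a \<alpha>})
      = {l \<alpha>..u \<alpha>}" for \<alpha>
    by (simp add: l_def u_def)
  have small: "\<bar>k * x - k * y\<bar> < e" if "\<bar>x - y\<bar> < e / (\<bar>k\<bar> + 1)" "0 < e" for x y e :: real
  proof -
    have "\<bar>k * x - k * y\<bar> = \<bar>k\<bar> * \<bar>x - y\<bar>" by (simp add: abs_mult flip: right_diff_distrib)
    also have "\<dots> \<le> (\<bar>k\<bar> + 1) * \<bar>x - y\<bar>" by (intro mult_right_mono) auto
    also have "\<dots> < e" using that by (simp add: pos_less_divide_eq mult.commute)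
    finally show ?thesis .
  qed
  show ?thesis
    unfolding fuzzy_scale_def lu
  proof (rule level_description[OF fuzzy_representation assms])
    fix \<alpha> :: real assume "0 \<le> \<alpha>" "\<alpha> \<le> 1"
    then show "l \<alpha> \<le> u \<alpha>"
      using level_eq_Icc(2)[of \<alpha> a] by (auto simp: l_def u_def mult_left_mono mult_left_mono_neg)
  next
    fix \<alpha> \<beta> :: real assume "0 \<le> \<alpha>" "\<alpha> \<le> \<beta>" "\<beta> \<le> 1"
    then show "l \<alpha> \<le> l \<beta> \<and> u \<beta> \<le> u \<alpha>"
      using lower_upper_mono[of \<alpha> \<beta> a]
      by (auto simp: l_def u_def mult_left_mono mult_left_mono_neg)
  next
    fix \<alpha> e :: real assume A: "0 < \<alpha>" "\<alpha> \<le> 1" "0 < e"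
    obtain \<beta> where b: "0 \<le> \<beta>" "\<beta> < \<alpha>" "lower a \<alpha> - e / (\<bar>k\<bar> + 1) < lower a \<beta>"
        "upper a \<beta> < upper a \<alpha> + e / (\<bar>k\<bar> + 1)"
      using level_left_continuous[of \<alpha> "e / (\<bar>k\<bar> + 1)" a] A by auto
    then have "\<bar>k * lower a \<beta> - k * lower a \<alpha>\<bar> < e" "\<bar>k * upper a \<beta> - k * upper a \<alpha>\<bar> < e"
      using lower_upper_mono[of \<beta> \<alpha> a] A by (intro small; linarith)+
    then show "\<exists>\<beta>. 0 \<le> \<beta> \<and> \<beta> < \<alpha> \<and> l \<alpha> - e < l \<beta> \<and> u \<beta> < u \<alpha> + e"
      using b(1,2) unfolding l_def u_def by (intro exI[of _ \<beta>]) (cases "k \<ge> 0"; simp; linarith)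
  next
    fix e :: real assume A: "0 < e"
    obtain \<beta> where b: "0 < \<beta>" "\<beta> \<le> 1" "lower a \<beta> < lower a 0 + e / (\<bar>k\<bar> + 1)"
        "upper a 0 - e / (\<bar>k\<bar> + 1) < upper a \<beta>"
      using level_right_continuous_0[of "e / (\<bar>k\<bar> + 1)" a] A by auto
    then have "\<bar>k * lower a \<beta> - k * lower a 0\<bar> < e" "\<bar>k * upper a \<beta> - k * upper a 0\<bar> < e"
      using lower_upper_mono[of 0 \<beta> a] A by (intro small; linarith)+
    then show "\<exists>\<beta>. 0 < \<beta> \<and> \<beta> \<le> 1 \<and> l \<beta> < l 0 + e \<and> u 0 - e < u \<beta>"
      using b(1,2) unfolding l_def u_def by (intro exI[of _ \<beta>]) (cases "k \<ge> 0"; simp; linarith)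
  qed
qed

definition is_gH_diff :: "fuzzy \<Rightarrow> fuzzy \<Rightarrow> fuzzy \<Rightarrow> bool" where
  "is_gH_diff a b c \<longleftrightarrow> a = fuzzy_add b c \<or> b = fuzzy_add a (fuzzy_scale (-1) c)"

definition gH_diff :: "fuzzy \<Rightarrow> fuzzy \<Rightarrow> fuzzy" where
  "gH_diff a b = (THE c. is_gH_diff a b c)"

definition has_gH_derivative :: "(real \<Rightarrow> fuzzy) \<Rightarrow> fuzzy \<Rightarrow> real \<Rightarrow> bool" where
  "has_gH_derivative g D x0 \<longleftrightarrow>
     (\<forall>\<^sub>F h in at 0. \<exists>c. is_gH_diff (g (x0 + h)) (g x0) c) \<and>
     ((\<lambda>h. fuzzy_scale (1 / h) (gH_diff (g (x0 + h)) (g x0))) \<longlongrightarrow> D) (at 0)"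

definition has_partial_gH :: "(real ^ 'n \<Rightarrow> fuzzy) \<Rightarrow> 'n \<Rightarrow> fuzzy \<Rightarrow> real ^ 'n \<Rightarrow> bool" where
  "has_partial_gH f i D x \<longleftrightarrow>
     has_gH_derivative (\<lambda>t. f (\<chi> j. if j = i then t else x $ j)) D (x $ i)"

definition partial_gH :: "(real ^ 'n \<Rightarrow> fuzzy) \<Rightarrow> 'n \<Rightarrow> real ^ 'n \<Rightarrow> fuzzy" where
  "partial_gH f i x = (THE D. has_partial_gH f i D x)"

text \<open>All notions below depend only on the values of \<open>f\<close> near \<open>x\<close>, so for an open set \<open>X\<close>
  a map defined on \<open>X\<close> may be represented by any total extension of it.\<close>

definition gH_differentiable_at :: "(real ^ 'n \<Rightarrow> fuzzy) \<Rightarrow> real ^ 'n \<Rightarrow> bool" where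
  "gH_differentiable_at f x \<longleftrightarrow>
     (\<exists>k. (\<exists>D. has_partial_gH f k D x) \<and>
          (\<forall>i. i \<noteq> k \<longrightarrow>
             (\<forall>\<^sub>F y in nhds x. \<exists>D. has_partial_gH f i D y) \<and>
             isCont (partial_gH f i) x))"

definition gH_differentiable_on :: "(real ^ 'n \<Rightarrow> fuzzy) \<Rightarrow> (real ^ 'n) set \<Rightarrow> bool" where
  "gH_differentiable_on f X \<longleftrightarrow> (\<forall>x\<in>X. gH_differentiable_at f x)"

definition fuzzy_local_minimizer ::
    "(real ^ 'n \<Rightarrow> fuzzy) \<Rightarrow> (real ^ 'n) set \<Rightarrow> real ^ 'n \<Rightarrow> bool" where
  "fuzzy_local_minimizer f X xs \<longleftrightarrow>
     xs \<in> X \<and> (\<exists>e>0. \<forall>x\<in>X. norm (x - xs) < e \<longrightarrow> fuzzy_le (f xs) (f x))"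

definition gradient :: "(real ^ 'n \<Rightarrow> real) \<Rightarrow> real ^ 'n \<Rightarrow> real ^ 'n" where
  "gradient g x = (THE D. GDERIV g x :> D)"

end

theory Submission
  imports Defs
begin

text \<open>
  The end points of the level sets need not be differentiable, but for fixed \<open>\<alpha>\<close> the sum
  of the two end points is additive, homogeneous and continuous on fuzzy numbers, and so is the
  integral that defines the order. Such a functional turns gH-derivatives into ordinary ones: the two
  alternatives in the gH-difference give it the same value. Hence each sum of end points has the
  partial derivatives obtained by evaluating it at the partial gH-derivatives, and the classical
  criterion (one partial derivative at the point, the others nearby and continuous) makes it
  differentiable. Applied to the integral functional, the same principle identifies the integral in
  the theorem, componentwise, with a partial derivative of a real function at a local minimum.
\<close>

section \<open>End points under fuzzy arithmetic, and uniqueness of gH-differences and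
  gH-derivatives\<close>

lemma lower_upper_fuzzy_add:
  assumes "\<alpha> \<in> {0..1}"
  shows "lower (fuzzy_add a b) \<alpha> = lower a \<alpha> + lower b \<alpha>"
    and "upper (fuzzy_add a b) \<alpha> = upper a \<alpha> + upper b \<alpha>"
proof -
  have "lower a \<alpha> + lower b \<alpha> \<le> upper a \<alpha> + upper b \<alpha>"
    using assms by (intro add_mono level_eq_Icc(2))
  then show "lower (fuzzy_add a b) \<alpha> = lower a \<alpha> + lower b \<alpha>"
    and "upper (fuzzy_add a b) \<alpha> = upper a \<alpha> + upper b \<alpha>"
    by (simp_all add: lower_def[of "fuzzy_add a b"] upper_def[of "fuzzy_add a b"]
        level_fuzzy_add[OF assms])
qed

lemma lower_upper_fuzzy_scale:
  assumes "\<alpha> \<in> {0..1}"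
  shows "lower (fuzzy_scale k a) \<alpha> = (if k \<ge> 0 then k * lower a \<alpha> else k * upper a \<alpha>)"
    and "upper (fuzzy_scale k a) \<alpha> = (if k \<ge> 0 then k * upper a \<alpha> else k * lower a \<alpha>)"
  using level_eq_Icc(2)[OF assms, of a]
  by (simp_all add: lower_def[of "fuzzy_scale k a"] upper_def[of "fuzzy_scale k a"]
      level_fuzzy_scale[OF assms] mult_left_mono mult_left_mono_neg)

text \<open>Either alternative forces the end points of the difference at each level to be
  \<open>lower a \<alpha> - lower b \<alpha>\<close> and
  \<open>upper a \<alpha> - upper b \<alpha>\<close> in some order. Since \<open>lower\<close> never
  exceeds \<open>upper\<close>, the order is determined, even if \<open>c\<close> and
  \<open>d\<close> arise from different alternatives.\<close>

lemma is_gH_diff_unique: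
  assumes "is_gH_diff a b c" and "is_gH_diff a b d"
  shows "c = d"
proof (rule fuzzy_eqI')
  fix \<alpha> :: real assume \<alpha>: "\<alpha> \<in> {0..1}"
  have "(lower e \<alpha> = lower a \<alpha> - lower b \<alpha> \<and> upper e \<alpha> = upper a \<alpha> - upper b \<alpha>) \<or>
      (lower e \<alpha> = upper a \<alpha> - upper b \<alpha> \<and> upper e \<alpha> = lower a \<alpha> - lower b \<alpha>)"
    if "is_gH_diff a b e" for e
    using that unfolding is_gH_diff_def
    by (auto simp: lower_upper_fuzzy_add[OF \<alpha>] lower_upper_fuzzy_scale[OF \<alpha>])
  from this[OF assms(1)] this[OF assms(2)]
  show "lower c \<alpha> = lower d \<alpha> \<and> upper c \<alpha> = upper d \<alpha>"
    using level_eq_Icc(2)[OF \<alpha>, of c] level_eq_Icc(2)[OF \<alpha>, of d] by linarith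
qed

lemma is_gH_diff_gH_diff:
  assumes "is_gH_diff a b c"
  shows "is_gH_diff a b (gH_diff a b)"
  unfolding gH_diff_def
  using assms is_gH_diff_unique[OF _ assms] by (rule theI[of "is_gH_diff a b"])

lemma has_gH_derivative_unique:
  assumes "has_gH_derivative g D x" and "has_gH_derivative g E x"
  shows "D = E"
  using assms unfolding has_gH_derivative_def by (auto intro: tendsto_unique[OF at_neq_bot])

lemma has_partial_gH_partial_gH:
  assumes "has_partial_gH f i D x"
  shows "has_partial_gH f i (partial_gH f i x) x"
  unfolding partial_gH_def using assms
  by (rule theI[of "\<lambda>D. has_partial_gH f i D x"])
    (use assms has_gH_derivative_unique in \<open>auto simp: has_partial_gH_def\<close>)

section \<open>Continuous linear functionals on fuzzy numbers\<close>

text \<open>Linearity sends the gH-quotient to the ordinary difference quotient of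
  \<open>\<phi> (g t)\<close>, and continuity carries its limit to \<open>\<phi> D\<close>.\<close>

lemma has_gH_derivative_linear_functional:
  fixes \<phi> :: "fuzzy \<Rightarrow> real"
  assumes cont: "continuous_on UNIV \<phi>"
    and add: "\<And>a b. \<phi> (fuzzy_add a b) = \<phi> a + \<phi> b"
    and scale: "\<And>k a. \<phi> (fuzzy_scale k a) = k * \<phi> a"
    and g: "has_gH_derivative g D x"
  shows "((\<lambda>t. \<phi> (g t)) has_real_derivative \<phi> D) (at x)"
  unfolding DERIV_def
proof (rule Lim_transform_eventually)
  have "isCont \<phi> D"
    using cont by (simp add: continuous_on_eq_continuous_at)
  then show "((\<lambda>h. \<phi> (fuzzy_scale (1 / h) (gH_diff (g (x + h)) (g x)))) \<longlongrightarrow> \<phi> D) (at 0)"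
    using g unfolding has_gH_derivative_def by (auto intro: isCont_tendsto_compose)
  \<comment> \<open>The gH-difference is known to exist only for small \<open>h\<close>, so the two
    quotients are compared only eventually.\<close>
  have "\<forall>\<^sub>F h in at 0. \<exists>c. is_gH_diff (g (x + h)) (g x) c"
    using g unfolding has_gH_derivative_def by blast
  then show "\<forall>\<^sub>F h in at 0. \<phi> (fuzzy_scale (1 / h) (gH_diff (g (x + h)) (g x))) =
      (\<phi> (g (x + h)) - \<phi> (g x)) / h"
  proof eventually_elim
    case (elim h)
    then have "is_gH_diff (g (x + h)) (g x) (gH_diff (g (x + h)) (g x))"
      using is_gH_diff_gH_diff by blast
    then have "\<phi> (gH_diff (g (x + h)) (g x)) = \<phi> (g (x + h)) - \<phi> (g x)"
      unfolding is_gH_diff_def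
    proof
      assume "g (x + h) = fuzzy_add (g x) (gH_diff (g (x + h)) (g x))"
      from arg_cong[OF this, of \<phi>] show ?thesis by (simp add: add)
    next
      assume "g x = fuzzy_add (g (x + h)) (fuzzy_scale (- 1) (gH_diff (g (x + h)) (g x)))"
      from arg_cong[OF this, of \<phi>] show ?thesis by (simp add: add scale)
    qed
    then show ?case by (simp add: scale)
  qed
qed

text \<open>A negative scalar swaps the end points, so neither of them alone is homogeneous; their
  sum is.\<close>

definition level_sum :: "real \<Rightarrow> fuzzy \<Rightarrow> real" where
  "level_sum \<alpha> a = lower a \<alpha> + upper a \<alpha>"

lemma level_sum_fuzzy_add:
  "\<alpha> \<in> {0..1} \<Longrightarrow> level_sum \<alpha> (fuzzy_add a b) = level_sum \<alpha> a + level_sum \<alpha> b"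
  by (simp add: level_sum_def lower_upper_fuzzy_add)

lemma level_sum_fuzzy_scale:
  "\<alpha> \<in> {0..1} \<Longrightarrow> level_sum \<alpha> (fuzzy_scale k a) = k * level_sum \<alpha> a"
  by (simp add: level_sum_def lower_upper_fuzzy_scale distrib_left)

lemma level_sum_lipschitz:
  "\<alpha> \<in> {0..1} \<Longrightarrow> \<bar>level_sum \<alpha> a - level_sum \<alpha> b\<bar> \<le> 2 * dist a b"
  using dist_fuzzy_ge[of \<alpha> a b] unfolding level_sum_def by linarith

lemma continuous_on_level_sum:
  assumes "\<alpha> \<in> {0..1}"
  shows "continuous_on UNIV (level_sum \<alpha>)"
  using level_sum_lipschitz[OF assms]
  by (intro lipschitz_on_continuous_on[of 2] lipschitz_onI) (auto simp: dist_real_def)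

definition score :: "fuzzy \<Rightarrow> real" where
  "score a = integral {0..1} (\<lambda>\<alpha>. \<alpha> * level_sum \<alpha> a)"

lemma fuzzy_le_iff_score_le: "fuzzy_le a b \<longleftrightarrow> score a \<le> score b"
  by (simp add: fuzzy_le_def score_def level_sum_def)

lemma has_integral_score:
  "((\<lambda>\<alpha>. \<alpha> * level_sum \<alpha> a) has_integral score a) {0..1}"
proof -
  \<comment> \<open>Subtracting the values at level 0 makes the second factors nonnegative and
    nondecreasing, so their products with \<alpha> are monotone and hence integrable.\<close>
  have "(\<lambda>\<alpha>. \<alpha> * (lower a \<alpha> - lower a 0)) integrable_on {0..1}"
      "(\<lambda>\<alpha>. \<alpha> * (upper a 0 - upper a \<alpha>)) integrable_on {0..1}"
    using lower_upper_mono[of _ _ a]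
    by (intro integrable_on_mono_on mono_onI mult_mono; simp)+
  moreover have "(\<lambda>\<alpha>. \<alpha> * (lower a 0 + upper a 0)) integrable_on {0..1}"
    by (intro integrable_continuous_interval continuous_intros)
  ultimately have "(\<lambda>\<alpha>. \<alpha> * (lower a \<alpha> - lower a 0) - \<alpha> * (upper a 0 - upper a \<alpha>) +
      \<alpha> * (lower a 0 + upper a 0)) integrable_on {0..1}"
    by (intro integrable_add integrable_diff)
  then have "(\<lambda>\<alpha>. \<alpha> * level_sum \<alpha> a) integrable_on {0..1}"
    by (simp add: level_sum_def algebra_simps)
  then show ?thesis
    unfolding score_def by (rule integrable_integral)
qed

lemma score_fuzzy_add: "score (fuzzy_add a b) = score a + score b"
proof -
  have "((\<lambda>\<alpha>. \<alpha> * level_sum \<alpha> (fuzzy_add a b)) has_integral score a + score b) {0..1}"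
    using has_integral_add[OF has_integral_score[of a] has_integral_score[of b]]
    by (rule has_integral_eq[rotated]) (simp add: level_sum_fuzzy_add distrib_left)
  then show ?thesis
    using has_integral_score has_integral_unique by blast
qed

lemma score_fuzzy_scale: "score (fuzzy_scale k a) = k * score a"
proof -
  have "((\<lambda>\<alpha>. \<alpha> * level_sum \<alpha> (fuzzy_scale k a)) has_integral k * score a) {0..1}"
    using has_integral_mult_right[OF has_integral_score[of a], of k]
    by (rule has_integral_eq[rotated]) (simp add: level_sum_fuzzy_scale)
  then show ?thesis
    using has_integral_score has_integral_unique by blast
qed

text \<open>The weight \<alpha> is at most 1 on an interval of length 1, so the Lipschitz constant
  of \<open>level_sum\<close> survives integration.\<close>

lemma score_lipschitz: "\<bar>score a - score b\<bar> \<le> 2 * dist a b"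
proof -
  have "((\<lambda>\<alpha>. \<alpha> * (level_sum \<alpha> a - level_sum \<alpha> b)) has_integral score a - score b) (cbox 0 1)"
    using has_integral_diff[OF has_integral_score[of a] has_integral_score[of b]]
    by (simp add: right_diff_distrib)
  moreover have "norm (\<alpha> * (level_sum \<alpha> a - level_sum \<alpha> b)) \<le> 2 * dist a b"
    if "\<alpha> \<in> cbox 0 1" for \<alpha>
  proof -
    have "\<bar>\<alpha>\<bar> * \<bar>level_sum \<alpha> a - level_sum \<alpha> b\<bar> \<le> 1 * (2 * dist a b)"
      using that by (intro mult_mono level_sum_lipschitz) auto
    then show ?thesis by (simp add: abs_mult)
  qed
  ultimately have "norm (score a - score b) \<le> 2 * dist a b * measure lborel (cbox 0 (1::real))"
    by (intro has_integral_bound) auto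
  then show ?thesis by simp
qed

lemma continuous_on_score: "continuous_on UNIV score"
  using score_lipschitz
  by (intro lipschitz_on_continuous_on[of 2] lipschitz_onI) (auto simp: dist_real_def)

section \<open>Differentiability from partial derivatives\<close>

definition replace_coord :: "'n \<Rightarrow> real \<Rightarrow> real ^ 'n \<Rightarrow> real ^ 'n" where
  "replace_coord i t x = (\<chi> j. if j = i then t else x $ j)"

lemma replace_coord_simps [simp]:
  "replace_coord i t x $ j = (if j = i then t else x $ j)"
  "replace_coord i s (replace_coord i t x) = replace_coord i s x"
  "replace_coord i (x $ i) x = x"
  by (auto simp: replace_coord_def vec_eq_iff)

text \<open>The increment is applied one coordinate at a time. Coordinate \<open>k\<close> moves
  first, while all others still agree with \<open>x\<close>, so its derivative at \<open>x\<close>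
  suffices; every later move is controlled by a mean value estimate and continuity of
  \<open>p i\<close>.\<close>

lemma partial_derivatives_imp_has_derivative:
  fixes g :: "real ^ 'n \<Rightarrow> real" and p :: "'n \<Rightarrow> real ^ 'n \<Rightarrow> real"
  assumes k: "((\<lambda>t. g (replace_coord k t x)) has_real_derivative p k x) (at (x $ k))"
    and near: "\<And>i. i \<noteq> k \<Longrightarrow> \<forall>\<^sub>F y in nhds x.
      ((\<lambda>t. g (replace_coord i t y)) has_real_derivative p i y) (at (y $ i))"
    and cont: "\<And>i. i \<noteq> k \<Longrightarrow> isCont (p i) x"
  shows "(g has_derivative (\<lambda>h. \<Sum>i\<in>UNIV. p i x * h $ i)) (at x)"
proof -
  define part where "part S h = (\<chi> j. if j \<in> S then h $ j else 0)"
    for S :: "'n set" and h :: "real ^ 'n"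
  have part_nth [simp]: "part S h $ j = (if j \<in> S then h $ j else 0)" for S h j
    by (simp add: part_def)
  \<comment> \<open>First-order approximation for increments truncated to \<open>insert k S\<close>;
    inserting \<open>k\<close> everywhere makes it the base case of the induction on
    \<open>S\<close>.\<close>
  have approx: "\<forall>e>0. \<exists>d>0. \<forall>h. norm h < d \<longrightarrow>
      \<bar>g (x + part (insert k S) h) - g x - (\<Sum>i\<in>insert k S. p i x * h $ i)\<bar> \<le> e * norm h"
    if "finite S" "k \<notin> S" for S
    using that
  proof (induction S rule: finite_induct)
    case empty
    show ?case
    proof (intro allI impI)
      fix e :: real assume "e > 0"
      then obtain d where d: "d > 0" "\<And>t. \<bar>t - x $ k\<bar> < d \<Longrightarrow>
          \<bar>g (replace_coord k t x) - g x - p k x * (t - x $ k)\<bar> \<le> e * \<bar>t - x $ k\<bar>"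
        using k unfolding has_field_derivative_def has_derivative_at_alt by auto
      have "\<bar>g (x + part {k} h) - g x - (\<Sum>i\<in>{k}. p i x * h $ i)\<bar> \<le> e * norm h"
        if "norm h < d" for h
      proof -
        have hk: "\<bar>h $ k\<bar> \<le> norm h" by (rule component_le_norm_cart)
        have "x + part {k} h = replace_coord k (x $ k + h $ k) x"
          by (simp add: vec_eq_iff)
        then have "\<bar>g (x + part {k} h) - g x - (\<Sum>i\<in>{k}. p i x * h $ i)\<bar> \<le> e * \<bar>h $ k\<bar>"
          using d(2)[of "x $ k + h $ k"] hk that by simp
        also have "\<dots> \<le> e * norm h"
          using hk \<open>e > 0\<close> by (intro mult_left_mono) auto
        finally show ?thesis .
      qed
      then show "\<exists>d>0. \<forall>h. norm h < d \<longrightarrow>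
          \<bar>g (x + part {k} h) - g x - (\<Sum>i\<in>{k}. p i x * h $ i)\<bar> \<le> e * norm h"
        using d(1) by blast
    qed
  next
    case (insert i S)
    define T where "T = insert k S"
    have i: "i \<noteq> k" "i \<notin> T" "finite T" "insert k (insert i S) = insert i T"
      using insert by (auto simp: T_def)
    show ?case
      unfolding i(4)
    proof (intro allI impI)
      fix e :: real assume "e > 0"
      \<comment> \<open>One half of the error pays for the coordinates in \<open>T\<close>, the
        other for moving coordinate \<open>i\<close>.\<close>
      then have e: "e / 2 > 0" by simp
      obtain d1 where d1: "d1 > 0" "\<And>h. norm h < d1 \<Longrightarrow>
          \<bar>g (x + part T h) - g x - (\<Sum>j\<in>T. p j x * h $ j)\<bar> \<le> e / 2 * norm h"
        using insert e unfolding T_def by blast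
      have "\<forall>\<^sub>F y in nhds x. \<bar>p i y - p i x\<bar> < e / 2"
        using cont[OF i(1)] e
        unfolding continuous_at_eps_delta eventually_nhds_metric dist_real_def by blast
      with near[OF i(1)] have "\<forall>\<^sub>F y in nhds x. \<bar>p i y - p i x\<bar> < e / 2 \<and>
          ((\<lambda>t. g (replace_coord i t y)) has_real_derivative p i y) (at (y $ i))"
        by eventually_elim auto
      then obtain d2 where d2: "d2 > 0" "\<And>y. dist y x < d2 \<Longrightarrow> \<bar>p i y - p i x\<bar> < e / 2"
          "\<And>y. dist y x < d2 \<Longrightarrow>
            ((\<lambda>t. g (replace_coord i t y)) has_real_derivative p i y) (at (y $ i))"
        unfolding eventually_nhds_metric by blast
      have "\<bar>g (x + part (insert i T) h) - g x - (\<Sum>j\<in>insert i T. p j x * h $ j)\<bar> \<le> e * norm h"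
        if h: "norm h < min d1 d2" for h
      proof -
        define y where "y = x + part T h"
        \<comment> \<open>With the linear term removed, the derivative is
          \<open>p i (replace_coord i t y) - p i x\<close>, which is small near
          \<open>x\<close>.\<close>
        define \<psi> where "\<psi> t = g (replace_coord i t y) - p i x * t" for t
        let ?I = "closed_segment (x $ i) (x $ i + h $ i)"
        have yi: "y $ i = x $ i" using i by (simp add: y_def)
        have der: "(\<psi> has_real_derivative p i (replace_coord i t y) - p i x) (at t within ?I)"
          and bound: "norm (p i (replace_coord i t y) - p i x) \<le> e / 2" if t: "t \<in> ?I" for t
        proof -
          have "\<bar>t - x $ i\<bar> \<le> \<bar>h $ i\<bar>"
            using t by (auto simp: closed_segment_eq_real_ivl split: if_splits)
          \<comment> \<open>Coordinates of the difference are those of \<open>h\<close> on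
            \<open>T\<close>, at most \<open>\<bar>h $ i\<bar>\<close> at \<open>i\<close>, and 0
            elsewhere; hence the whole segment stays within \<open>d2\<close> of
            \<open>x\<close>.\<close>
          then have "norm (replace_coord i t y - x) \<le> norm h"
            by (intro norm_le_componentwise_cart) (simp add: y_def)
          then have z: "dist (replace_coord i t y) x < d2" using h by (simp add: dist_norm)
          show "(\<psi> has_real_derivative p i (replace_coord i t y) - p i x) (at t within ?I)"
            unfolding \<psi>_def
            using d2(3)[OF z]
            by (auto intro!: derivative_eq_intros intro: has_field_derivative_at_within)
          show "norm (p i (replace_coord i t y) - p i x) \<le> e / 2"
            using d2(2)[OF z] by simp
        qed
        have "norm (\<psi> (x $ i + h $ i) - \<psi> (x $ i)) \<le> e / 2 * norm (x $ i + h $ i - x $ i)"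
          by (rule field_differentiable_bound[OF convex_closed_segment der bound]) auto
        also have "\<dots> \<le> e / 2 * norm h"
          using e component_le_norm_cart[of h i] by (intro mult_left_mono) auto
        finally have "\<bar>\<psi> (x $ i + h $ i) - \<psi> (x $ i)\<bar> \<le> e / 2 * norm h" by simp
        moreover have "replace_coord i (x $ i + h $ i) y = x + part (insert i T) h"
          using i by (auto simp: vec_eq_iff y_def)
        then have "\<psi> (x $ i + h $ i) - \<psi> (x $ i) =
            g (x + part (insert i T) h) - g (x + part T h) - p i x * h $ i"
          using replace_coord_simps(3)[of i y]
          by (simp add: \<psi>_def yi distrib_left) (simp add: y_def)
        moreover have "\<bar>g (x + part T h) - g x - (\<Sum>j\<in>T. p j x * h $ j)\<bar> \<le> e / 2 * norm h"
          using d1(2) h by simp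
        ultimately show ?thesis
          unfolding sum.insert[OF i(3,2)] by linarith
      qed
      then show "\<exists>d>0. \<forall>h. norm h < d \<longrightarrow>
          \<bar>g (x + part (insert i T) h) - g x - (\<Sum>j\<in>insert i T. p j x * h $ j)\<bar> \<le> e * norm h"
        using d1(1) d2(1) by (intro exI[of _ "min d1 d2"]) auto
    qed
  qed
  \<comment> \<open>Once every coordinate has moved, the truncated increment is \<open>h\<close>
    itself.\<close>
  have all: "insert k (UNIV - {k}) = UNIV" by auto
  have "part UNIV h = h" for h by (simp add: vec_eq_iff)
  with approx[of "UNIV - {k}"] have "\<exists>d>0. \<forall>h. norm h < d \<longrightarrow>
      \<bar>g (x + h) - g x - (\<Sum>i\<in>UNIV. p i x * h $ i)\<bar> \<le> e * norm h" if "e > 0" for e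
    using that by (simp add: all)
  then have "\<exists>d>0. \<forall>y. norm (y - x) < d \<longrightarrow>
      norm (g (x + (y - x)) - g x - (\<Sum>i\<in>UNIV. p i x * (y - x) $ i)) \<le> e * norm (y - x)"
    if "e > 0" for e
    unfolding real_norm_def using that by blast
  then have "\<forall>e>0. \<exists>d>0. \<forall>y. norm (y - x) < d \<longrightarrow>
      norm (g y - g x - (\<Sum>i\<in>UNIV. p i x * (y - x) $ i)) \<le> e * norm (y - x)"
    by simp
  moreover have "bounded_linear (\<lambda>h. \<Sum>i\<in>UNIV. p i x * h $ i)"
    by (intro bounded_linear_sum bounded_linear_const_mult bounded_linear_vec_nth)
  ultimately show ?thesis
    unfolding has_derivative_at_alt by blast
qed

section \<open>Gradients of the level sums and the minimum condition\<close>

lemma gradient_eqI: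
  assumes "GDERIV g x :> D"
  shows "gradient g x = D"
  unfolding gradient_def
proof (rule the_equality)
  show "GDERIV g x :> D" by (fact assms)
  fix E assume "GDERIV g x :> E"
  then have "(\<lambda>h. h \<bullet> E) = (\<lambda>h. h \<bullet> D)"
    using assms unfolding gderiv_def by (rule has_derivative_unique)
  then show "E = D"
    by (metis vector_eq_ldot)
qed

lemma has_partial_gH_linear_functional:
  fixes \<phi> :: "fuzzy \<Rightarrow> real"
  assumes "continuous_on UNIV \<phi>"
    and "\<And>a b. \<phi> (fuzzy_add a b) = \<phi> a + \<phi> b"
    and "\<And>k a. \<phi> (fuzzy_scale k a) = k * \<phi> a"
    and "has_partial_gH f i D x"
  shows "((\<lambda>t. \<phi> (f (replace_coord i t x))) has_real_derivative \<phi> D) (at (x $ i))"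
  using has_gH_derivative_linear_functional[OF assms(1-3) assms(4)[unfolded has_partial_gH_def]]
  unfolding replace_coord_def .

text \<open>For the coordinates other than the distinguished one, existence on a neighbourhood
  includes existence at \<open>x\<close>.\<close>

lemma gH_differentiable_imp_has_partial_gH:
  assumes "gH_differentiable_at f x"
  shows "has_partial_gH f i (partial_gH f i x) x"
proof -
  obtain k where "\<exists>D. has_partial_gH f k D x"
      "i \<noteq> k \<Longrightarrow> \<forall>\<^sub>F y in nhds x. \<exists>D. has_partial_gH f i D y"
    using assms unfolding gH_differentiable_at_def by blast
  then have "\<exists>D. has_partial_gH f i D x"
    using eventually_nhds_x_imp_x[of "\<lambda>y. \<exists>D. has_partial_gH f i D y" x] by (cases "i = k") auto
  then show ?thesis using has_partial_gH_partial_gH by blast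
qed

text \<open>The distinguished coordinate of gH-differentiability becomes the one in the classical
  criterion. The explicit gradient allows the integrand of the theorem to be computed
  componentwise.\<close>

lemma GDERIV_level_sum:
  assumes f: "gH_differentiable_at f x" and \<alpha>: "\<alpha> \<in> {0..1}"
  shows "GDERIV (\<lambda>y. level_sum \<alpha> (f y)) x :> (\<chi> i. level_sum \<alpha> (partial_gH f i x))"
proof -
  obtain k where k: "\<And>i. i \<noteq> k \<Longrightarrow> \<forall>\<^sub>F y in nhds x. \<exists>D. has_partial_gH f i D y"
      "\<And>i. i \<noteq> k \<Longrightarrow> isCont (partial_gH f i) x"
    using f unfolding gH_differentiable_at_def by blast
  have partial: "((\<lambda>t. level_sum \<alpha> (f (replace_coord i t y))) has_real_derivative
      level_sum \<alpha> (partial_gH f i y)) (at (y $ i))" if "has_partial_gH f i D y" for i y D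
    using has_partial_gH_partial_gH[OF that] \<alpha>
    by (intro has_partial_gH_linear_functional continuous_on_level_sum
        level_sum_fuzzy_add level_sum_fuzzy_scale)
  have "((\<lambda>y. level_sum \<alpha> (f y)) has_derivative
      (\<lambda>h. \<Sum>i\<in>UNIV. level_sum \<alpha> (partial_gH f i x) * h $ i)) (at x)"
  proof (rule partial_derivatives_imp_has_derivative)
    show "((\<lambda>t. level_sum \<alpha> (f (replace_coord k t x))) has_real_derivative
        level_sum \<alpha> (partial_gH f k x)) (at (x $ k))"
      using partial gH_differentiable_imp_has_partial_gH[OF f] by blast
    fix i assume "i \<noteq> k"
    show "\<forall>\<^sub>F y in nhds x. ((\<lambda>t. level_sum \<alpha> (f (replace_coord i t y))) has_real_derivative
        level_sum \<alpha> (partial_gH f i y)) (at (y $ i))"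
      using k(1)[OF \<open>i \<noteq> k\<close>] by (rule eventually_mono) (use partial in blast)
    have "isCont (level_sum \<alpha>) (partial_gH f i x)"
      using continuous_on_level_sum[OF \<alpha>] by (simp add: continuous_on_eq_continuous_at)
    then show "isCont (\<lambda>y. level_sum \<alpha> (partial_gH f i y)) x"
      using k(2)[OF \<open>i \<noteq> k\<close>] by (rule isCont_o2[rotated])
  qed
  then show ?thesis
    by (simp add: gderiv_def inner_vec_def mult.commute)
qed

text \<open>Along the \<open>i\<close>-th coordinate line, \<open>score\<close> composed with
  \<open>f\<close> is a real function with a local minimum at \<open>xs $ i\<close>, and its
  derivative there is the \<open>score\<close> of the partial gH-derivative.\<close>

lemma score_partial_gH_local_minimizer:
  assumes X: "open X" and f: "gH_differentiable_at f xs" and m: "fuzzy_local_minimizer f X xs"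
  shows "score (partial_gH f i xs) = 0"
proof -
  obtain e where e: "e > 0" "xs \<in> X"
      "\<And>x. x \<in> X \<Longrightarrow> norm (x - xs) < e \<Longrightarrow> score (f xs) \<le> score (f x)"
    using m unfolding fuzzy_local_minimizer_def fuzzy_le_iff_score_le by blast
  obtain d where d: "d > 0" "ball xs d \<subseteq> X"
    using X e(2) open_contains_ball by blast
  have "((\<lambda>t. score (f (replace_coord i t xs))) has_real_derivative
      score (partial_gH f i xs)) (at (xs $ i))"
    using gH_differentiable_imp_has_partial_gH[OF f]
    by (intro has_partial_gH_linear_functional continuous_on_score score_fuzzy_add score_fuzzy_scale)
  \<comment> \<open>Radius \<open>d\<close> keeps the moved point in \<open>X\<close>; radius
    \<open>e\<close> keeps it where minimality applies.\<close>
  moreover have "0 < min d e" using d e by simp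
  moreover have "\<forall>t. \<bar>xs $ i - t\<bar> < min d e \<longrightarrow>
      score (f (replace_coord i (xs $ i) xs)) \<le> score (f (replace_coord i t xs))"
  proof (intro allI impI)
    fix t assume t: "\<bar>xs $ i - t\<bar> < min d e"
    have "replace_coord i t xs - xs = (t - xs $ i) *\<^sub>R axis i 1"
      by (simp add: vec_eq_iff axis_def)
    then have n: "norm (replace_coord i t xs - xs) < min d e"
      using t by (simp add: abs_minus_commute)
    then have "replace_coord i t xs \<in> X"
      using d(2) by (auto simp: dist_norm norm_minus_commute)
    then show "score (f (replace_coord i (xs $ i) xs)) \<le> score (f (replace_coord i t xs))"
      using e(3) n by simp
  qed
  ultimately show ?thesis by (rule DERIV_local_min)
qed

theorem theorem3p1:
  fixes f :: "real ^ 'n \<Rightarrow> fuzzy" and X :: "(real ^ 'n) set" and xs :: "real ^ 'n"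
  assumes "open X"
    and "gH_differentiable_on f X"
    and "fuzzy_local_minimizer f X xs"
  shows "(\<forall>\<alpha>\<in>{0..1}. (\<lambda>x. lower (f x) \<alpha> + upper (f x) \<alpha>) differentiable (at xs)) \<and>
    ((\<lambda>\<alpha>. \<alpha> *\<^sub>R gradient (\<lambda>x. lower (f x) \<alpha> + upper (f x) \<alpha>) xs) has_integral 0) {0..1}"
proof
  have f: "gH_differentiable_at f xs"
    using assms unfolding gH_differentiable_on_def fuzzy_local_minimizer_def by blast
  note grad = GDERIV_level_sum[OF f, unfolded level_sum_def]
  show "\<forall>\<alpha>\<in>{0..1}. (\<lambda>x. lower (f x) \<alpha> + upper (f x) \<alpha>) differentiable (at xs)"
    using grad unfolding gderiv_def differentiable_def by blast
  \<comment> \<open>Component \<open>i\<close> of this integral is the \<open>score\<close> of the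
    \<open>i\<close>-th partial gH-derivative, which vanishes.\<close>
  have "((\<lambda>\<alpha>. \<alpha> *\<^sub>R (\<chi> i. level_sum \<alpha> (partial_gH f i xs))) has_integral 0) {0..1}"
    unfolding has_integral_componentwise_iff[where y = "0 :: real ^ 'n"]
  proof
    fix b :: "real ^ 'n" assume "b \<in> Basis"
    then obtain i where b: "b = axis i 1" by (auto simp: Basis_vec_def)
    show "((\<lambda>\<alpha>. (\<alpha> *\<^sub>R (\<chi> i. level_sum \<alpha> (partial_gH f i xs))) \<bullet> b) has_integral 0 \<bullet> b) {0..1}"
      using has_integral_score[of "partial_gH f i xs"]
        score_partial_gH_local_minimizer[OF assms(1) f assms(3), of i]
      by (simp add: b inner_axis)
  qed
  then show "((\<lambda>\<alpha>. \<alpha> *\<^sub>R gradient (\<lambda>x. lower (f x) \<alpha> + upper (f x) \<alpha>) xs) has_integral 0) {0..1}"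
    \<comment> \<open>The integrands need to agree only on \<open>{0..1}\<close>, exactly the levels
      covered by \<open>grad\<close>.\<close>
    by (rule has_integral_eq[rotated]) (simp add: gradient_eqI[OF grad] level_sum_def)
qed

end
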